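(* (Soundness for Sets.) For any set of formulas $\Gamma$ and formula $A$ of $\mathcal{L}$: if $\Gamma\vdash A$ then $\Gamma\vDash A$.
   Context: Language $\mathcal{L}$: first-order, with variables $V$ (which may occur free), individual constants, function symbols, predicate symbols, identity $=$, a one-place existence predicate $\exists!$, connectives $\neg,\rightarrow$, quantifier $\forall$, and the binary quantifier $I$: if $A,B$ are formulas and $x$ a variable, $Ix[A,B]$ is a formula binding $x$ in $A$ and $B$. $A_t^x$ is substitution of $t$ for $x$ ($t$ free for $x$). Sequents $\Gamma\Rightarrow\Delta$ have finite sets of formulas on each side. The system $\mathbf{CPF}^I$ has axioms $A\Rightarrow A$ and the rules: Cut; weakening and contraction; $(L\neg)$: $\Gamma\Rightarrow\Delta,A$ / $\neg A,\Gamma\Rightarrow\Delta$; $(R\neg)$: $A,\Gamma\Rightarrow\Delta$ / $\Gamma\Rightarrow\Delta,\neg A$; $(L\rightarrow)$: $\Gamma\Rightarrow\Delta,A$ and $B,\Gamma\Rightarrow\Delta$ / $A\rightarrow B,\Gamma\Rightarrow\Delta$; $(R\rightarrow)$: $A,\Gamma\Rightarrow\Delta,B$ / $\Gamma\Rightarrow\Delta,A\rightarrow B$; $(L\forall)$: $A_t^x,\Gamma\Rightarrow\Delta$ / $\exists!t,\forall xA,\Gamma\Rightarrow\Delta$; $(R\forall)$: $\exists!a,\Gamma\Rightarrow\Delta,A_a^x$ / $\Gamma\Rightarrow\Delta,\forall xA$; identity: $A_{t_2}^x,\Gamma\Rightarrow\Delta$ / $t_1=t_2,A_{t_1}^x,\Gamma\Rightarrow\Delta$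 ($A$ atomic), and $t=t,\Gamma\Rightarrow\Delta$ / $\Gamma\Rightarrow\Delta$; $(RI)$: $\Gamma\Rightarrow\Delta,A_t^x$, $\Gamma\Rightarrow\Delta,B_t^x$, $A_a^x,\Gamma\Rightarrow\Delta,a=t$ / $\Gamma\Rightarrow\Delta,Ix[A,B]$; $(LI^1)$: $A_a^x,B_a^x,\Gamma\Rightarrow\Delta$ / $Ix[A,B],\Gamma\Rightarrow\Delta$; $(LI^2)$: $\Gamma\Rightarrow\Delta,A_{t_1}^x$, $\Gamma\Rightarrow\Delta,A_{t_2}^x$, $\Gamma\Rightarrow\Delta,C_{t_2}^x$ / $Ix[A,B],\Gamma\Rightarrow\Delta,C_{t_1}^x$ ($C$ atomic). In $(R\forall)$, $(RI)$, $(LI^1)$ the eigen-term $a$ (a variable or constant) must not occur in the conclusion. $\Gamma\vdash A$ means: for some finite $\Gamma_0\subseteq\Gamma$, $\Gamma_0\Rightarrow A$ is derivable in $\mathbf{CPF}^I$. A structure $\mathfrak{A}$ consists of a non-empty domain $|\mathfrak{A}|$, an inner domain $|\mathfrak{A}^\forall|\subseteq|\mathfrak{A}|$ (possibly empty), which is also the interpretation of $\exists!$, relations $P^\mathfrak{A}\subseteq|\mathfrak{A}|^n$, elements $c^\mathfrak{A}\in|\mathfrak{A}|$, operations $f^\mathfrak{A}\colon|\mathfrak{A}|^n\to|\mathfrak{A}|$. For $s\colon V\to|\mathfrak{A}|$, $\overline{s}$ is its extension to terms and $s(x|d)$ is $s$ modified to send $x$ to $d$. Satisfaction: $\vDash_\mathfrak{A}t_1=t_2[s]$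 iff $\overline{s}(t_1)=\overline{s}(t_2)$; $\vDash_\mathfrak{A}\exists!t[s]$ iff $\overline{s}(t)\in|\mathfrak{A}^\forall|$; atomic $Pt_1\dots t_n$ as usual; $\neg,\rightarrow$ classically; $\vDash_\mathfrak{A}\forall xA[s]$ iff $\vDash_\mathfrak{A}A[s(x|d)]$ for every $d\in|\mathfrak{A}^\forall|$; $\vDash_\mathfrak{A}Ix[A,B][s]$ iff there is $d\in|\mathfrak{A}|$ with $\vDash_\mathfrak{A}A[s(x|d)]$, no other $e\in|\mathfrak{A}|$ with $\vDash_\mathfrak{A}A[s(x|e)]$, and $\vDash_\mathfrak{A}B[s(x|d)]$. $\Gamma\vDash A$ means: for every structure $\mathfrak{A}$ and every $s\colon V\to|\mathfrak{A}|$ with which $\mathfrak{A}$ satisfies every member of $\Gamma$, $\mathfrak{A}$ satisfies $A$ with $s$.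
   Formalization: In (RI) the eigen-term a is also required not to occur in t; with only "a not in the conclusion", taking t = a and A = B = (x = x) derives ⇒ Ix[x=x, x=x], which fails in any domain with two elements. *)

theory Defs
  imports Main "HOL-Library.FSet"
begin

text \<open>
  The variables and the individual constants, function symbols and predicate symbols of the
  language are the elements of four arbitrary types \<open>'v\<close>, \<open>'c\<close>, \<open>'f\<close>, \<open>'p\<close>; the arities are given by
  a record. The datatypes contain raw expressions, and the predicates \<open>is_term\<close> and \<open>is_formula\<close>
  single out the ones that respect the arities.
\<close>

record ('f, 'p) language =
  fun_arity :: "'f \<Rightarrow> nat"
  pred_arity :: "'p \<Rightarrow> nat"

datatype ('v, 'c, 'f) tm =
  Var 'v
| Const 'c
| Fun 'f "('v, 'c, 'f) tm list"

datatype ('v, 'c, 'f, 'p) fm =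
  Pred 'p "('v, 'c, 'f) tm list"
| Eq "('v, 'c, 'f) tm" "('v, 'c, 'f) tm"
| Existence "('v, 'c, 'f) tm"
| Neg "('v, 'c, 'f, 'p) fm"
| Imp "('v, 'c, 'f, 'p) fm" "('v, 'c, 'f, 'p) fm"
| Forall 'v "('v, 'c, 'f, 'p) fm"
| Iota 'v "('v, 'c, 'f, 'p) fm" "('v, 'c, 'f, 'p) fm"

fun is_term :: "('f, 'p) language \<Rightarrow> ('v, 'c, 'f) tm \<Rightarrow> bool" where
  "is_term L (Var x) \<longleftrightarrow> True"
| "is_term L (Const c) \<longleftrightarrow> True"
| "is_term L (Fun f ts) \<longleftrightarrow> length ts = fun_arity L f \<and> (\<forall>t\<in>set ts. is_term L t)"

fun is_formula :: "('f, 'p) language \<Rightarrow> ('v, 'c, 'f, 'p) fm \<Rightarrow> bool" where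
  "is_formula L (Pred P ts) \<longleftrightarrow> length ts = pred_arity L P \<and> (\<forall>t\<in>set ts. is_term L t)"
| "is_formula L (Eq t u) \<longleftrightarrow> is_term L t \<and> is_term L u"
| "is_formula L (Existence t) \<longleftrightarrow> is_term L t"
| "is_formula L (Neg A) \<longleftrightarrow> is_formula L A"
| "is_formula L (Imp A B) \<longleftrightarrow> is_formula L A \<and> is_formula L B"
| "is_formula L (Forall x A) \<longleftrightarrow> is_formula L A"
| "is_formula L (Iota x A B) \<longleftrightarrow> is_formula L A \<and> is_formula L B"

fun atomic :: "('v, 'c, 'f, 'p) fm \<Rightarrow> bool" where
  "atomic (Pred P ts) \<longleftrightarrow> True"
| "atomic (Eq t u) \<longleftrightarrow> True"
| "atomic (Existence t) \<longleftrightarrow> True"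
| "atomic _ \<longleftrightarrow> False"

fun vars_tm :: "('v, 'c, 'f) tm \<Rightarrow> 'v set" where
  "vars_tm (Var x) = {x}"
| "vars_tm (Const c) = {}"
| "vars_tm (Fun f ts) = (\<Union>t\<in>set ts. vars_tm t)"

fun free_vars :: "('v, 'c, 'f, 'p) fm \<Rightarrow> 'v set" where
  "free_vars (Pred P ts) = (\<Union>t\<in>set ts. vars_tm t)"
| "free_vars (Eq t u) = vars_tm t \<union> vars_tm u"
| "free_vars (Existence t) = vars_tm t"
| "free_vars (Neg A) = free_vars A"
| "free_vars (Imp A B) = free_vars A \<union> free_vars B"
| "free_vars (Forall x A) = free_vars A - {x}"
| "free_vars (Iota x A B) = (free_vars A \<union> free_vars B) - {x}"

text \<open>
  \<open>subst A x t\<close> is $A_t^x$. It does not rename bound variables, so it is used only together with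
  the condition \<open>free_for t x A\<close>.
\<close>

fun subst_tm :: "('v, 'c, 'f) tm \<Rightarrow> 'v \<Rightarrow> ('v, 'c, 'f) tm \<Rightarrow> ('v, 'c, 'f) tm" where
  "subst_tm (Var y) x t = (if y = x then t else Var y)"
| "subst_tm (Const c) x t = Const c"
| "subst_tm (Fun f us) x t = Fun f (map (\<lambda>u. subst_tm u x t) us)"

fun subst :: "('v, 'c, 'f, 'p) fm \<Rightarrow> 'v \<Rightarrow> ('v, 'c, 'f) tm \<Rightarrow> ('v, 'c, 'f, 'p) fm" where
  "subst (Pred P us) x t = Pred P (map (\<lambda>u. subst_tm u x t) us)"
| "subst (Eq u v) x t = Eq (subst_tm u x t) (subst_tm v x t)"
| "subst (Existence u) x t = Existence (subst_tm u x t)"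
| "subst (Neg A) x t = Neg (subst A x t)"
| "subst (Imp A B) x t = Imp (subst A x t) (subst B x t)"
| "subst (Forall y A) x t = (if y = x then Forall y A else Forall y (subst A x t))"
| "subst (Iota y A B) x t = (if y = x then Iota y A B else Iota y (subst A x t) (subst B x t))"

fun free_for :: "('v, 'c, 'f) tm \<Rightarrow> 'v \<Rightarrow> ('v, 'c, 'f, 'p) fm \<Rightarrow> bool" where
  "free_for t x (Pred P us) \<longleftrightarrow> True"
| "free_for t x (Eq u v) \<longleftrightarrow> True"
| "free_for t x (Existence u) \<longleftrightarrow> True"
| "free_for t x (Neg A) \<longleftrightarrow> free_for t x A"
| "free_for t x (Imp A B) \<longleftrightarrow> free_for t x A \<and> free_for t x B"
| "free_for t x (Forall y A) \<longleftrightarrow>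
     x \<notin> free_vars (Forall y A) \<or> y \<notin> vars_tm t \<and> free_for t x A"
| "free_for t x (Iota y A B) \<longleftrightarrow>
     x \<notin> free_vars (Iota y A B) \<or> y \<notin> vars_tm t \<and> free_for t x A \<and> free_for t x B"

text \<open>
  The terms that occur in an expression. A variable also occurs where it is bound, and the
  \<open>x\<close> of a quantifier counts as an occurrence of \<open>x\<close>.
\<close>

fun subterms :: "('v, 'c, 'f) tm \<Rightarrow> ('v, 'c, 'f) tm set" where
  "subterms (Var x) = {Var x}"
| "subterms (Const c) = {Const c}"
| "subterms (Fun f ts) = insert (Fun f ts) (\<Union>t\<in>set ts. subterms t)"

fun terms_of :: "('v, 'c, 'f, 'p) fm \<Rightarrow> ('v, 'c, 'f) tm set" where
  "terms_of (Pred P ts) = (\<Union>t\<in>set ts. subterms t)"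
| "terms_of (Eq t u) = subterms t \<union> subterms u"
| "terms_of (Existence t) = subterms t"
| "terms_of (Neg A) = terms_of A"
| "terms_of (Imp A B) = terms_of A \<union> terms_of B"
| "terms_of (Forall x A) = insert (Var x) (terms_of A)"
| "terms_of (Iota x A B) = insert (Var x) (terms_of A \<union> terms_of B)"

definition eigen_term :: "('v, 'c, 'f) tm \<Rightarrow> bool" where
  "eigen_term a \<longleftrightarrow> (\<exists>x. a = Var x) \<or> (\<exists>c. a = Const c)"

definition fresh_in_sequent ::
  "('v, 'c, 'f) tm \<Rightarrow> ('v, 'c, 'f, 'p) fm fset \<Rightarrow> ('v, 'c, 'f, 'p) fm fset \<Rightarrow> bool" where
  "fresh_in_sequent a \<Gamma> \<Delta> \<longleftrightarrow> (\<forall>A. A |\<in>| \<Gamma> |\<union>| \<Delta> \<longrightarrow> a \<notin> terms_of A)"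

text \<open>
  In \<open>RI\<close> the term \<open>t\<close> is not visible in the conclusion, and the eigen-term must not occur in it
  either: with \<open>a\<close> itself as \<open>t\<close> one could otherwise derive \<open>Ix[x = x, x = x]\<close> from \<open>a = a\<close>, which
  fails in every structure with two elements in its domain.

  Since the sides of a sequent are sets, contraction is trivial, and the version of cut with
  separate contexts contains the one with shared contexts.
\<close>

inductive CPFI ::
  "('f, 'p) language \<Rightarrow> ('v, 'c, 'f, 'p) fm fset \<Rightarrow> ('v, 'c, 'f, 'p) fm fset \<Rightarrow> bool"
  for L :: "('f, 'p) language"
where
  Ax: "is_formula L A \<Longrightarrow> CPFI L {|A|} {|A|}"
| Cut: "CPFI L \<Gamma> (finsert A \<Delta>) \<Longrightarrow> CPFI L (finsert A \<Gamma>') \<Delta>' \<Longrightarrow> CPFI L (\<Gamma> |\<union>| \<Gamma>') (\<Delta> |\<union>| \<Delta>')"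
| LW: "is_formula L A \<Longrightarrow> CPFI L \<Gamma> \<Delta> \<Longrightarrow> CPFI L (finsert A \<Gamma>) \<Delta>"
| RW: "is_formula L A \<Longrightarrow> CPFI L \<Gamma> \<Delta> \<Longrightarrow> CPFI L \<Gamma> (finsert A \<Delta>)"
| LC: "CPFI L (finsert A (finsert A \<Gamma>)) \<Delta> \<Longrightarrow> CPFI L (finsert A \<Gamma>) \<Delta>"
| RC: "CPFI L \<Gamma> (finsert A (finsert A \<Delta>)) \<Longrightarrow> CPFI L \<Gamma> (finsert A \<Delta>)"
| LNeg: "CPFI L \<Gamma> (finsert A \<Delta>) \<Longrightarrow> CPFI L (finsert (Neg A) \<Gamma>) \<Delta>"
| RNeg: "CPFI L (finsert A \<Gamma>) \<Delta> \<Longrightarrow> CPFI L \<Gamma> (finsert (Neg A) \<Delta>)"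
| LImp: "CPFI L \<Gamma> (finsert A \<Delta>) \<Longrightarrow> CPFI L (finsert B \<Gamma>) \<Delta> \<Longrightarrow>
    CPFI L (finsert (Imp A B) \<Gamma>) \<Delta>"
| RImp: "CPFI L (finsert A \<Gamma>) (finsert B \<Delta>) \<Longrightarrow> CPFI L \<Gamma> (finsert (Imp A B) \<Delta>)"
| LForall: "is_formula L A \<Longrightarrow> is_term L t \<Longrightarrow> free_for t x A \<Longrightarrow>
    CPFI L (finsert (subst A x t) \<Gamma>) \<Delta> \<Longrightarrow>
    CPFI L (finsert (Existence t) (finsert (Forall x A) \<Gamma>)) \<Delta>"
| RForall: "is_formula L A \<Longrightarrow> eigen_term a \<Longrightarrow> free_for a x A \<Longrightarrow>
    fresh_in_sequent a \<Gamma> (finsert (Forall x A) \<Delta>) \<Longrightarrow>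
    CPFI L (finsert (Existence a) \<Gamma>) (finsert (subst A x a) \<Delta>) \<Longrightarrow>
    CPFI L \<Gamma> (finsert (Forall x A) \<Delta>)"
| EqSubst: "is_formula L A \<Longrightarrow> atomic A \<Longrightarrow> is_term L t\<^sub>1 \<Longrightarrow> is_term L t\<^sub>2 \<Longrightarrow>
    CPFI L (finsert (subst A x t\<^sub>2) \<Gamma>) \<Delta> \<Longrightarrow>
    CPFI L (finsert (Eq t\<^sub>1 t\<^sub>2) (finsert (subst A x t\<^sub>1) \<Gamma>)) \<Delta>"
| EqRefl: "CPFI L (finsert (Eq t t) \<Gamma>) \<Delta> \<Longrightarrow> CPFI L \<Gamma> \<Delta>"
| RI: "is_formula L A \<Longrightarrow> is_formula L B \<Longrightarrow> is_term L t \<Longrightarrow>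
    free_for t x A \<Longrightarrow> free_for t x B \<Longrightarrow>
    eigen_term a \<Longrightarrow> free_for a x A \<Longrightarrow>
    fresh_in_sequent a \<Gamma> (finsert (Iota x A B) \<Delta>) \<Longrightarrow> a \<notin> subterms t \<Longrightarrow>
    CPFI L \<Gamma> (finsert (subst A x t) \<Delta>) \<Longrightarrow>
    CPFI L \<Gamma> (finsert (subst B x t) \<Delta>) \<Longrightarrow>
    CPFI L (finsert (subst A x a) \<Gamma>) (finsert (Eq a t) \<Delta>) \<Longrightarrow>
    CPFI L \<Gamma> (finsert (Iota x A B) \<Delta>)"
| LI1: "is_formula L A \<Longrightarrow> is_formula L B \<Longrightarrow>
    eigen_term a \<Longrightarrow> free_for a x A \<Longrightarrow> free_for a x B \<Longrightarrow>
    fresh_in_sequent a (finsert (Iota x A B) \<Gamma>) \<Delta> \<Longrightarrow>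
    CPFI L (finsert (subst A x a) (finsert (subst B x a) \<Gamma>)) \<Delta> \<Longrightarrow>
    CPFI L (finsert (Iota x A B) \<Gamma>) \<Delta>"
| LI2: "is_formula L A \<Longrightarrow> is_formula L B \<Longrightarrow> is_formula L C \<Longrightarrow> atomic C \<Longrightarrow>
    is_term L t\<^sub>1 \<Longrightarrow> is_term L t\<^sub>2 \<Longrightarrow> free_for t\<^sub>1 x A \<Longrightarrow> free_for t\<^sub>2 x A \<Longrightarrow>
    CPFI L \<Gamma> (finsert (subst A x t\<^sub>1) \<Delta>) \<Longrightarrow>
    CPFI L \<Gamma> (finsert (subst A x t\<^sub>2) \<Delta>) \<Longrightarrow>
    CPFI L \<Gamma> (finsert (subst C x t\<^sub>2) \<Delta>) \<Longrightarrow>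
    CPFI L (finsert (Iota x A B) \<Gamma>) (finsert (subst C x t\<^sub>1) \<Delta>)"

definition derivable ::
  "('f, 'p) language \<Rightarrow> ('v, 'c, 'f, 'p) fm set \<Rightarrow> ('v, 'c, 'f, 'p) fm \<Rightarrow> bool" where
  "derivable L \<Gamma> A \<longleftrightarrow> (\<exists>\<Gamma>\<^sub>0. fset \<Gamma>\<^sub>0 \<subseteq> \<Gamma> \<and> CPFI L \<Gamma>\<^sub>0 {|A|})"

record ('c, 'f, 'p, 'd) struct =
  domain :: "'d set"
  inner_domain :: "'d set"
  pred_int :: "'p \<Rightarrow> 'd list set"
  const_int :: "'c \<Rightarrow> 'd"
  fun_int :: "'f \<Rightarrow> 'd list \<Rightarrow> 'd"

definition is_structure :: "('f, 'p) language \<Rightarrow> ('c, 'f, 'p, 'd) struct \<Rightarrow> bool" where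
  "is_structure L M \<longleftrightarrow>
     domain M \<noteq> {} \<and>
     inner_domain M \<subseteq> domain M \<and>
     (\<forall>P. pred_int M P \<subseteq> {ds. length ds = pred_arity L P \<and> set ds \<subseteq> domain M}) \<and>
     (\<forall>c. const_int M c \<in> domain M) \<and>
     (\<forall>f ds. length ds = fun_arity L f \<longrightarrow> set ds \<subseteq> domain M \<longrightarrow> fun_int M f ds \<in> domain M)"

fun eval_tm :: "('c, 'f, 'p, 'd) struct \<Rightarrow> ('v \<Rightarrow> 'd) \<Rightarrow> ('v, 'c, 'f) tm \<Rightarrow> 'd" where
  "eval_tm M s (Var x) = s x"
| "eval_tm M s (Const c) = const_int M c"
| "eval_tm M s (Fun f ts) = fun_int M f (map (eval_tm M s) ts)"

fun sat :: "('c, 'f, 'p, 'd) struct \<Rightarrow> ('v \<Rightarrow> 'd) \<Rightarrow> ('v, 'c, 'f, 'p) fm \<Rightarrow> bool" where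
  "sat M s (Pred P ts) \<longleftrightarrow> map (eval_tm M s) ts \<in> pred_int M P"
| "sat M s (Eq t u) \<longleftrightarrow> eval_tm M s t = eval_tm M s u"
| "sat M s (Existence t) \<longleftrightarrow> eval_tm M s t \<in> inner_domain M"
| "sat M s (Neg A) \<longleftrightarrow> \<not> sat M s A"
| "sat M s (Imp A B) \<longleftrightarrow> (sat M s A \<longrightarrow> sat M s B)"
| "sat M s (Forall x A) \<longleftrightarrow> (\<forall>d\<in>inner_domain M. sat M (s(x := d)) A)"
| "sat M s (Iota x A B) \<longleftrightarrow>
     (\<exists>d\<in>domain M. sat M (s(x := d)) A \<and>
        \<not> (\<exists>e\<in>domain M. e \<noteq> d \<and> sat M (s(x := e)) A) \<and>
        sat M (s(x := d)) B)"

text \<open>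
  The type argument is the type from which the domains of the structures are taken. A theorem that
  leaves it as a type variable speaks about structures of every size.
\<close>

definition entails ::
  "'d itself \<Rightarrow> ('f, 'p) language \<Rightarrow> ('v, 'c, 'f, 'p) fm set \<Rightarrow> ('v, 'c, 'f, 'p) fm \<Rightarrow> bool" where
  "entails _ L \<Gamma> A \<longleftrightarrow>
     (\<forall>(M :: ('c, 'f, 'p, 'd) struct) (s :: 'v \<Rightarrow> 'd).
        is_structure L M \<longrightarrow> range s \<subseteq> domain M \<longrightarrow> (\<forall>B\<in>\<Gamma>. sat M s B) \<longrightarrow> sat M s A)"

end

theory Submission imports Defs begin

text \<open>
  Every rule preserves validity of sequents in all structures under all assignments. For the rules
  with an eigen-term \<open>a\<close>, the value of \<open>a\<close> is changed to an arbitrary object \<open>d\<close>: if \<open>a\<close> is a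
  variable this changes the assignment, if \<open>a\<close> is a constant it changes the structure. The
  validity of the premise is then used for the changed pair, which agrees with the original
  one on the formulas of the conclusion.
\<close>

section \<open>Evaluation, satisfaction and substitution\<close>

text \<open>The clause for \<open>Iota\<close> quantifies over the domain, so the terms in
  \<open>RI\<close> and \<open>LI2\<close> must be known to denote there.\<close>

lemma eval_tm_in_domain:
  assumes M: "is_structure L M" and s: "range s \<subseteq> domain M" and "is_term L t"
  shows "eval_tm M s t \<in> domain M"
  using assms(3)
proof (induction t)
  case (Var x)
  show ?case using s by auto
next
  case (Const c)
  show ?case using M by (simp add: is_structure_def)
next
  case (Fun f ts)
  then have "set (map (eval_tm M s) ts) \<subseteq> domain M" by auto
  moreover have "length (map (eval_tm M s) ts) = fun_arity L f" using Fun.prems by simp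
  moreover have "\<And>ds. length ds = fun_arity L f \<Longrightarrow> set ds \<subseteq> domain M \<Longrightarrow> fun_int M f ds \<in> domain M"
    using M by (simp add: is_structure_def)
  ultimately show ?case by (simp only: eval_tm.simps)
qed

lemma eval_tm_cong:
  assumes "\<And>x. x \<in> vars_tm t \<Longrightarrow> s x = s' x"
  shows "eval_tm M s t = eval_tm M s' t"
  using assms
proof (induction t)
  case (Fun f ts)
  then have "map (eval_tm M s) ts = map (eval_tm M s') ts" by auto
  then show ?case by (simp only: eval_tm.simps)
qed simp_all

lemma sat_cong:
  "(\<And>x. x \<in> free_vars A \<Longrightarrow> s x = s' x) \<Longrightarrow> sat M s A \<longleftrightarrow> sat M s' A"
proof (induction A arbitrary: s s')
  case (Pred P ts)
  then have "map (eval_tm M s) ts = map (eval_tm M s') ts" by (auto intro: eval_tm_cong)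
  then show ?case by (metis sat.simps(1))
next
  case (Eq t u)
  then have "eval_tm M s t = eval_tm M s' t" "eval_tm M s u = eval_tm M s' u"
    by (auto intro: eval_tm_cong)
  then show ?case by simp
next
  case (Existence t)
  then have "eval_tm M s t = eval_tm M s' t" by (auto intro: eval_tm_cong)
  then show ?case by simp
next
  case (Neg A)
  show ?case using Neg.IH[of s s'] Neg.prems by simp
next
  case (Imp A B)
  show ?case using Imp.IH[of s s'] Imp.prems by simp
next
  case (Forall x A)
  have "sat M (s(x := d)) A \<longleftrightarrow> sat M (s'(x := d)) A" for d
    using Forall.prems by (intro Forall.IH) auto
  then show ?case by simp
next
  case (Iota x A B)
  have "sat M (s(x := d)) A \<longleftrightarrow> sat M (s'(x := d)) A" for d
    using Iota.prems by (intro Iota.IH(1)) auto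
  moreover have "sat M (s(x := d)) B \<longleftrightarrow> sat M (s'(x := d)) B" for d
    using Iota.prems by (intro Iota.IH(2)) auto
  ultimately show ?case by simp
qed

lemma subst_tm_not_free: "x \<notin> vars_tm t \<Longrightarrow> subst_tm t x u = t"
  by (induction t) (auto intro: map_idI)

lemma subst_not_free: "x \<notin> free_vars A \<Longrightarrow> subst A x u = A"
  by (induction A) (auto intro: map_idI simp: subst_tm_not_free)

lemma eval_subst_tm: "eval_tm M s (subst_tm t x u) = eval_tm M (s(x := eval_tm M s u)) t"
proof (induction t)
  case (Fun f ts)
  then have "map (eval_tm M s) (map (\<lambda>t. subst_tm t x u) ts)
      = map (eval_tm M (s(x := eval_tm M s u))) ts"
    by (simp del: fun_upd_apply)
  then show ?case by (metis eval_tm.simps(3) subst_tm.simps(3))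
qed auto

text \<open>Substitution does nothing here and the value at \<open>x\<close> is irrelevant, so
  \<open>d\<close> is arbitrary. This handles binders where \<open>free_for\<close> holds only
  because \<open>x\<close> is not free, including the case that the binder binds \<open>x\<close>
  itself.\<close>

lemma sat_subst_not_free:
  assumes "x \<notin> free_vars A"
  shows "sat M s (subst A x t) \<longleftrightarrow> sat M (s(x := d)) A"
  unfolding subst_not_free[OF assms] using assms by (intro sat_cong) auto

text \<open>At a binder of \<open>y\<close> with \<open>x\<close> free, \<open>y\<close> differs
  from \<open>x\<close> and does not occur in \<open>t\<close>. Hence the updates at
  \<open>x\<close> and \<open>y\<close> commute and changing \<open>y\<close> leaves the value of
  \<open>t\<close> alone.\<close>

lemma sat_subst:
  "free_for t x A \<Longrightarrow> sat M s (subst A x t) \<longleftrightarrow> sat M (s(x := eval_tm M s t)) A"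
proof (induction A arbitrary: s)
  case (Pred P ts)
  then show ?case by (simp add: eval_subst_tm comp_def del: fun_upd_apply)
next
  case (Forall y A)
  show ?case
  proof (cases "x \<in> free_vars (Forall y A)")
    case True
    then have "y \<noteq> x" "y \<notin> vars_tm t" "free_for t x A" using Forall.prems by auto
    moreover from this have "eval_tm M (s(y := d)) t = eval_tm M s t" for d
      by (auto intro: eval_tm_cong)
    ultimately show ?thesis using Forall.IH by (simp add: fun_upd_twist del: fun_upd_apply)
  qed (rule sat_subst_not_free)
next
  case (Iota y A B)
  show ?case
  proof (cases "x \<in> free_vars (Iota y A B)")
    case True
    then have "y \<noteq> x" "y \<notin> vars_tm t" "free_for t x A" "free_for t x B"
      using Iota.prems by auto
    moreover from this have "eval_tm M (s(y := d)) t = eval_tm M s t" for d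
      by (auto intro: eval_tm_cong)
    ultimately show ?thesis using Iota.IH by (simp add: fun_upd_twist del: fun_upd_apply)
  qed (rule sat_subst_not_free)
qed (auto simp: eval_subst_tm)

text \<open>Supplies the substitutability condition that \<open>EqSubst\<close> and
  \<open>LI2\<close> do not state for their atomic formula.\<close>

lemma free_for_atomic: "atomic A \<Longrightarrow> free_for t x A"
  by (cases A) auto

section \<open>Changing the value of an eigen-term\<close>

text \<open>Together with \<open>struct_upd\<close> this treats variables and constants uniformly:
  each function acts on one kind and is the identity on the other. A compound term is never an
  eigen-term; its default, no change, keeps the freshness lemmas true for every
  \<open>a\<close>.\<close>

fun val_upd :: "('v \<Rightarrow> 'd) \<Rightarrow> ('v, 'c, 'f) tm \<Rightarrow> 'd \<Rightarrow> 'v \<Rightarrow> 'd" where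
  "val_upd s (Var x) d = s(x := d)"
| "val_upd s (Const c) d = s"
| "val_upd s (Fun f ts) d = s"

fun struct_upd ::
  "('c, 'f, 'p, 'd) struct \<Rightarrow> ('v, 'c, 'f) tm \<Rightarrow> 'd \<Rightarrow> ('c, 'f, 'p, 'd) struct" where
  "struct_upd M (Var x) d = M"
| "struct_upd M (Const c) d = M\<lparr>const_int := (const_int M)(c := d)\<rparr>"
| "struct_upd M (Fun f ts) d = M"

lemma struct_upd_simps [simp]:
  "domain (struct_upd M a d) = domain M"
  "inner_domain (struct_upd M a d) = inner_domain M"
  "pred_int (struct_upd M a d) = pred_int M"
  "fun_int (struct_upd M a d) = fun_int M"
  by (cases a; simp)+

lemma is_structure_struct_upd:
  "is_structure L M \<Longrightarrow> d \<in> domain M \<Longrightarrow> is_structure L (struct_upd M a d)"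
  by (cases a) (auto simp: is_structure_def)

lemma range_val_upd: "range s \<subseteq> D \<Longrightarrow> d \<in> D \<Longrightarrow> range (val_upd s a d) \<subseteq> D"
  by (cases a) auto

lemma eval_eigen_term: "eigen_term a \<Longrightarrow> eval_tm (struct_upd M a d) (val_upd s a d) a = d"
  by (auto simp: eigen_term_def)

lemma val_upd_twist: "a \<noteq> Var x \<Longrightarrow> (val_upd s a d)(x := e) = val_upd (s(x := e)) a d"
  by (cases a) (auto simp: fun_upd_twist)

lemma eval_tm_fresh:
  "a \<notin> subterms t \<Longrightarrow> eval_tm (struct_upd M a d) (val_upd s a d) t = eval_tm M s t"
proof (induction t)
  case (Fun f ts)
  then have "map (eval_tm (struct_upd M a d) (val_upd s a d)) ts = map (eval_tm M s) ts" by auto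
  then show ?case by (metis eval_tm.simps(3) struct_upd_simps(4))
qed (cases a; auto)+

text \<open>Since \<open>terms_of\<close> counts bound variables, freshness gives
  \<open>a \<noteq> Var x\<close> at a binder of \<open>x\<close>. The two updates then commute, and
  the induction hypothesis applies to \<open>s(x := e)\<close>.\<close>

lemma sat_fresh:
  "a \<notin> terms_of A \<Longrightarrow> sat (struct_upd M a d) (val_upd s a d) A \<longleftrightarrow> sat M s A"
proof (induction A arbitrary: s)
  case (Pred P ts)
  then have "map (eval_tm (struct_upd M a d) (val_upd s a d)) ts = map (eval_tm M s) ts"
    by (auto intro: eval_tm_fresh)
  then show ?case by (metis sat.simps(1) struct_upd_simps(3))
qed (auto simp: eval_tm_fresh val_upd_twist)

text \<open>After the change \<open>a\<close> denotes \<open>d\<close>, so substituting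
  \<open>a\<close> amounts to assigning \<open>d\<close> to \<open>x\<close>. As \<open>a\<close>
  does not occur in \<open>A\<close> itself, the change can then be undone.\<close>

lemma sat_subst_eigen_term:
  assumes "eigen_term a" "free_for a x A" "a \<noteq> Var x" "a \<notin> terms_of A"
  shows "sat (struct_upd M a d) (val_upd s a d) (subst A x a) \<longleftrightarrow> sat M (s(x := d)) A"
  using assms by (simp add: sat_subst eval_eigen_term val_upd_twist sat_fresh)

section \<open>Satisfaction of sequents and soundness of the rules\<close>

definition sat_sequent ::
  "('c, 'f, 'p, 'd) struct \<Rightarrow> ('v \<Rightarrow> 'd) \<Rightarrow>
    ('v, 'c, 'f, 'p) fm fset \<Rightarrow> ('v, 'c, 'f, 'p) fm fset \<Rightarrow> bool" where
  "sat_sequent M s \<Gamma> \<Delta> \<longleftrightarrow>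
     ((\<forall>B. B |\<in>| \<Gamma> \<longrightarrow> sat M s B) \<longrightarrow> (\<exists>B. B |\<in>| \<Delta> \<and> sat M s B))"

text \<open>This rule and its counterpart on the right detach the active formulas and keep the
  context as one proposition, which makes the cases of the connectives purely propositional.\<close>

lemma sat_sequent_finsert_left [simp]:
  "sat_sequent M s (finsert A \<Gamma>) \<Delta> \<longleftrightarrow> (sat M s A \<longrightarrow> sat_sequent M s \<Gamma> \<Delta>)"
  by (auto simp: sat_sequent_def)

lemma sat_sequent_finsert_right [simp]:
  "sat_sequent M s \<Gamma> (finsert A \<Delta>) \<longleftrightarrow> (sat M s A \<or> sat_sequent M s \<Gamma> \<Delta>)"
  by (auto simp: sat_sequent_def)

lemma sat_sequent_fresh:
  assumes "fresh_in_sequent a \<Gamma> \<Delta>"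
  shows "sat_sequent (struct_upd M a d) (val_upd s a d) \<Gamma> \<Delta> \<longleftrightarrow> sat_sequent M s \<Gamma> \<Delta>"
  using assms by (auto simp: sat_sequent_def fresh_in_sequent_def sat_fresh)

lemma fresh_in_sequent_simps:
  "fresh_in_sequent a (finsert A \<Gamma>) \<Delta> \<longleftrightarrow> a \<notin> terms_of A \<and> fresh_in_sequent a \<Gamma> \<Delta>"
  "fresh_in_sequent a \<Gamma> (finsert A \<Delta>) \<longleftrightarrow> a \<notin> terms_of A \<and> fresh_in_sequent a \<Gamma> \<Delta>"
  by (auto simp: fresh_in_sequent_def)

lemma CPFI_sound:
  assumes "CPFI L \<Gamma> \<Delta>" "is_structure L M" "range s \<subseteq> domain M"
  shows "sat_sequent M s \<Gamma> \<Delta>"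
  using assms
\<comment> \<open>Both \<open>M\<close> and \<open>s\<close> are generalized because the eigen-term
  cases use the premise for a changed pair.\<close>
proof (induction arbitrary: M s rule: CPFI.induct)
  case (Ax A)
  show ?case by (auto simp: sat_sequent_def)
next
  case (Cut \<Gamma> A \<Delta> \<Gamma>' \<Delta>')
  show ?case
    using Cut.IH(1)[OF Cut.prems] Cut.IH(2)[OF Cut.prems]
    unfolding sat_sequent_def by (simp only: finsert_iff funion_iff) blast
next
  case (LForall A t x \<Gamma> \<Delta>)
  show ?case
    using LForall.IH[OF LForall.prems] \<open>free_for t x A\<close> by (auto simp: sat_subst)
next
  case (RForall A a x \<Gamma> \<Delta>)
  \<comment> \<open>That \<open>a\<close> is not \<open>Var x\<close> follows because
    \<open>x\<close> counts as occurring in \<open>Forall x A\<close>.\<close>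
  have fresh: "a \<notin> terms_of A" "a \<noteq> Var x" "fresh_in_sequent a \<Gamma> \<Delta>"
    using RForall.hyps by (auto simp: fresh_in_sequent_simps)
  have "sat M (s(x := d)) A \<or> sat_sequent M s \<Gamma> \<Delta>" if "d \<in> inner_domain M" for d
  proof -
    have d: "d \<in> domain M" using that RForall.prems by (auto simp: is_structure_def)
    have "sat_sequent (struct_upd M a d) (val_upd s a d)
        (finsert (Existence a) \<Gamma>) (finsert (subst A x a) \<Delta>)"
      using RForall.prems d
      by (intro RForall.IH) (simp_all add: is_structure_struct_upd range_val_upd)
    then show ?thesis
      using that fresh RForall.hyps
      by (simp add: eval_eigen_term sat_subst_eigen_term sat_sequent_fresh)
  qed
  then show ?case by auto
next
  case (EqSubst A t\<^sub>1 t\<^sub>2 x \<Gamma> \<Delta>)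
  show ?case
    using EqSubst.IH[OF EqSubst.prems] \<open>atomic A\<close> by (auto simp: sat_subst free_for_atomic)
next
  case (RI A B t x a \<Gamma> \<Delta>)
  \<comment> \<open>The denotation of \<open>t\<close> is the witness for the \<open>Iota\<close>
    formula.\<close>
  let ?d = "eval_tm M s t"
  have fresh: "a \<notin> terms_of A" "a \<noteq> Var x" "fresh_in_sequent a \<Gamma> \<Delta>"
    using RI.hyps by (auto simp: fresh_in_sequent_simps)
  have d: "?d \<in> domain M" using RI.prems RI.hyps by (auto intro: eval_tm_in_domain)
  \<comment> \<open>Uniqueness comes from the third premise with \<open>a\<close> made to denote
    \<open>e\<close>; \<open>t\<close> keeps its value because \<open>a\<close> does not occur in
    it.\<close>
  have "e = ?d" if "\<not> sat_sequent M s \<Gamma> \<Delta>" "e \<in> domain M" "sat M (s(x := e)) A" for e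
  proof -
    have "sat_sequent (struct_upd M a e) (val_upd s a e)
        (finsert (subst A x a) \<Gamma>) (finsert (Eq a t) \<Delta>)"
      using RI.prems that
      by (intro RI.IH(3)) (simp_all add: is_structure_struct_upd range_val_upd)
    then show ?thesis
      using that fresh RI.hyps
      by (simp add: eval_eigen_term sat_subst_eigen_term sat_sequent_fresh eval_tm_fresh)
  qed
  moreover have "sat M (s(x := ?d)) A" "sat M (s(x := ?d)) B" if "\<not> sat_sequent M s \<Gamma> \<Delta>"
    using RI.IH(1,2)[OF RI.prems] RI.hyps that by (auto simp: sat_subst)
  ultimately have "sat M s (Iota x A B)" if "\<not> sat_sequent M s \<Gamma> \<Delta>"
    using d that unfolding sat.simps by blast
  then show ?case unfolding sat_sequent_finsert_right by blast
next
  case (LI1 A B a x \<Gamma> \<Delta>)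
  have fresh: "a \<notin> terms_of A" "a \<notin> terms_of B" "a \<noteq> Var x" "fresh_in_sequent a \<Gamma> \<Delta>"
    using LI1.hyps by (auto simp: fresh_in_sequent_simps)
  \<comment> \<open>Here \<open>d\<close> is the object that a true \<open>Iota x A B\<close>
    provides; the premise is read with \<open>a\<close> denoting it.\<close>
  have "sat_sequent M s \<Gamma> \<Delta>"
    if "d \<in> domain M" "sat M (s(x := d)) A" "sat M (s(x := d)) B" for d
  proof -
    have "sat_sequent (struct_upd M a d) (val_upd s a d)
        (finsert (subst A x a) (finsert (subst B x a) \<Gamma>)) \<Delta>"
      using LI1.prems that
      by (intro LI1.IH) (simp_all add: is_structure_struct_upd range_val_upd)
    then show ?thesis
      using that fresh LI1.hyps by (simp add: sat_subst_eigen_term sat_sequent_fresh)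
  qed
  then show ?case by auto
next
  case (LI2 A B C t\<^sub>1 t\<^sub>2 x \<Gamma> \<Delta>)
  have "eval_tm M s t\<^sub>1 \<in> domain M" "eval_tm M s t\<^sub>2 \<in> domain M"
    using LI2.prems LI2.hyps by (auto intro: eval_tm_in_domain)
  moreover have "sat M (s(x := eval_tm M s t\<^sub>1)) A" "sat M (s(x := eval_tm M s t\<^sub>2)) A"
    if "\<not> sat_sequent M s \<Gamma> \<Delta>"
    using LI2.IH(1,2)[OF LI2.prems] LI2.hyps that by (simp_all add: sat_subst)
  \<comment> \<open>Both values satisfy \<open>A\<close>, so each equals the unique such
    object.\<close>
  ultimately have "eval_tm M s t\<^sub>1 = eval_tm M s t\<^sub>2"
    if "sat M s (Iota x A B)" "\<not> sat_sequent M s \<Gamma> \<Delta>"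
    using that unfolding sat.simps by metis
  then have "sat M s (subst C x t\<^sub>1) \<longleftrightarrow> sat M s (subst C x t\<^sub>2)"
    if "sat M s (Iota x A B)" "\<not> sat_sequent M s \<Gamma> \<Delta>"
    using \<open>atomic C\<close> that by (simp add: sat_subst free_for_atomic)
  then show ?case
    using LI2.IH(3)[OF LI2.prems]
    unfolding sat_sequent_finsert_left sat_sequent_finsert_right by blast
next
  case (LW A \<Gamma> \<Delta>)
  show ?case using LW.IH[OF LW.prems] by auto
next
  case (RW A \<Gamma> \<Delta>)
  show ?case using RW.IH[OF RW.prems] by auto
next
  case (LC A \<Gamma> \<Delta>)
  show ?case using LC.IH[OF LC.prems] by auto
next
  case (RC \<Gamma> A \<Delta>)
  show ?case using RC.IH[OF RC.prems] by auto
next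
  case (LNeg \<Gamma> A \<Delta>)
  show ?case using LNeg.IH[OF LNeg.prems] by auto
next
  case (RNeg A \<Gamma> \<Delta>)
  show ?case using RNeg.IH[OF RNeg.prems] by auto
next
  case (RImp A \<Gamma> B \<Delta>)
  show ?case using RImp.IH[OF RImp.prems] by auto
next
  case (EqRefl t \<Gamma> \<Delta>)
  show ?case using EqRefl.IH[OF EqRefl.prems] by auto
next
  case (LImp \<Gamma> A \<Delta> B)
  show ?case using LImp.IH[OF LImp.prems] by auto
qed

theorem theorem3:
  fixes L :: "('f, 'p) language"
    and \<Gamma> :: "('v, 'c, 'f, 'p) fm set"
    and A :: "('v, 'c, 'f, 'p) fm"
  assumes "\<forall>B\<in>\<Gamma>. is_formula L B"
    and "is_formula L A"
    and "derivable L \<Gamma> A"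
  shows "entails TYPE('d) L \<Gamma> A"
proof -
  obtain \<Gamma>\<^sub>0 where \<Gamma>\<^sub>0: "fset \<Gamma>\<^sub>0 \<subseteq> \<Gamma>" "CPFI L \<Gamma>\<^sub>0 {|A|}"
    using assms(3) by (auto simp: derivable_def)
  \<comment> \<open>The right side of the derived sequent is a singleton, so the satisfied formula
    there can only be \<open>A\<close>.\<close>
  have "sat M s A" if "is_structure L M" "range s \<subseteq> domain M" "\<forall>B\<in>\<Gamma>. sat M s B"
    for M :: "('c, 'f, 'p, 'd) struct" and s
    using CPFI_sound[OF \<Gamma>\<^sub>0(2) that(1,2)] \<Gamma>\<^sub>0(1) that(3) unfolding sat_sequent_def by blast
  then show ?thesis by (auto simp: entails_def)
qed

end
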